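(* For every integer $d\ge 3$ there exists a $(d-1,d^2-d-1)$-tight $(d-1)$-dimensional simplicial complex that is not volume-rigid.
   Context: Sparsity. A $(d-1)$-dimensional simplicial complex $K$ is $(d-1,d^2-d-1)$-sparse if for every subset $A$ of its vertex set with $|A|\ge d$, the number of $(d-1)$-faces of $K$ contained in $A$ is at most $(d-1)|A|-(d^2-d-1)$; it is $(d-1,d^2-d-1)$-tight if in addition equality holds when $A$ is the entire vertex set. Volume rigidity. Let $K$ be a $(d-1)$-dimensional simplicial complex with $n$ vertices. A map $\mathbf p:V(K)\to\mathbb R^{d-1}$ is generic if its $(d-1)n$ coordinates are algebraically independent over $\mathbb Q$. For a $(d-1)$-face $\sigma=\{v_1<\dots<v_d\}$ of $K$ (for a fixed total order on the vertices) let $M_{\mathbf p,\sigma}=\begin{pmatrix}\mathbf p(v_1)&\cdots&\mathbf p(v_d)\\1&\cdots&1\end{pmatrix}$, a $d\times d$ matrix. The volume-rigidity matrix $\mathfrak V(K,\mathbf p)$ is the $(d-1)n\times f_{d-1}(K)$ matrix ($f_{d-1}(K)$ is the number of $(d-1)$-faces of $K$) whose columns are indexed by the $(d-1)$-faces of $K$, whose rows are grouped in blocks of $d-1$ rows, one block per vertex, and whose column for $\sigma=\{v_1,\dots,v_d\}$ has as its $j$-th coordinate in the block of $v_i$ ($i\in[d]$, $j\in[d-1]$) the derivative of $\det M_{\mathbf p,\sigma}$ with respect to the $j$-th coordinate of $\mathbf p(v_i)$, i.e. the cofactor of $M_{\mathbf p,\sigma}$ at row $j$ and column $i$; all other entries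 are $0$. $K$ is volume-rigid if $\operatorname{rank}\mathfrak V(K,\mathbf p)=(d-1)n-(d^2-d-1)$ for a generic $\mathbf p:V(K)\to\mathbb R^{d-1}$. *)

theory Defs
  imports
    Complex_Main
    "HOL-Library.Poly_Mapping"
    "Jordan_Normal_Form.Determinant"
    "Jordan_Normal_Form.DL_Rank"
begin

text \<open>
  Finite abstract simplicial complexes. The empty set counts as a face (of dimension \<open>-1\<close>),
  and every vertex in \<open>vertices K\<close> is itself a face.
\<close>

definition abstract_complex :: "'a set set \<Rightarrow> bool" where
  "abstract_complex K \<longleftrightarrow>
     K \<noteq> {} \<and> finite K \<and> (\<forall>\<sigma>\<in>K. finite \<sigma>) \<and> (\<forall>\<sigma>\<in>K. \<forall>\<tau>. \<tau> \<subseteq> \<sigma> \<longrightarrow> \<tau> \<in> K)"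

definition vertices :: "'a set set \<Rightarrow> 'a set" where
  "vertices K = \<Union>K"

definition complex_dim :: "'a set set \<Rightarrow> int" where
  "complex_dim K = Max ((\<lambda>\<sigma>. int (card \<sigma>) - 1) ` K)"

text \<open>
  Throughout, the complex under consideration has dimension \<open>d - 1\<close>, so that its
  \<open>(d-1)\<close>-faces are the faces with \<open>d\<close> vertices.
\<close>

definition top_faces :: "nat \<Rightarrow> 'a set set \<Rightarrow> 'a set set" where
  "top_faces d K = {\<sigma> \<in> K. card \<sigma> = d}"

definition sparse :: "nat \<Rightarrow> int \<Rightarrow> int \<Rightarrow> 'a set set \<Rightarrow> bool" where
  "sparse d k l K \<longleftrightarrow>
     (\<forall>A. A \<subseteq> vertices K \<and> d \<le> card A \<longrightarrow>
        int (card {\<sigma> \<in> top_faces d K. \<sigma> \<subseteq> A}) \<le> k * int (card A) - l)"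

definition tight :: "nat \<Rightarrow> int \<Rightarrow> int \<Rightarrow> 'a set set \<Rightarrow> bool" where
  "tight d k l K \<longleftrightarrow>
     sparse d k l K \<and>
     int (card (top_faces d K)) = k * int (card (vertices K)) - l"

text \<open>
  Polynomials over the rationals in variables of type \<open>'i\<close> are finitely supported maps from
  monomials, which are finitely supported exponent maps, to coefficients.
\<close>

definition eval_poly :: "('i \<Rightarrow> real) \<Rightarrow> (('i \<Rightarrow>\<^sub>0 nat) \<Rightarrow>\<^sub>0 rat) \<Rightarrow> real" where
  "eval_poly x P =
     (\<Sum>m \<in> Poly_Mapping.keys P. of_rat (Poly_Mapping.lookup P m) *
        (\<Prod>i \<in> Poly_Mapping.keys m. x i ^ Poly_Mapping.lookup m i))"

definition alg_independent_over_rat :: "('i \<Rightarrow> real) \<Rightarrow> 'i set \<Rightarrow> bool" where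
  "alg_independent_over_rat x I \<longleftrightarrow>
     (\<forall>P. (\<forall>m \<in> Poly_Mapping.keys P. Poly_Mapping.keys m \<subseteq> I) \<and> eval_poly x P = 0 \<longrightarrow> P = 0)"

text \<open>
  A placement of the vertices in \<open>(d-1)\<close>-dimensional real space is a map \<open>p\<close> where \<open>p v j\<close>,
  for \<open>j < d - 1\<close>, is the \<open>j\<close>-th coordinate of the point assigned to \<open>v\<close>. Values of \<open>p\<close> at
  non-vertices or at other \<open>j\<close> are irrelevant.
\<close>

definition generic :: "nat \<Rightarrow> 'a set set \<Rightarrow> ('a \<Rightarrow> nat \<Rightarrow> real) \<Rightarrow> bool" where
  "generic d K p \<longleftrightarrow> alg_independent_over_rat (\<lambda>(v, j). p v j) (vertices K \<times> {..<d - 1})"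

definition face_mat :: "nat \<Rightarrow> ('a::linorder \<Rightarrow> nat \<Rightarrow> real) \<Rightarrow> 'a set \<Rightarrow> real mat" where
  "face_mat d p \<sigma> =
     mat d d (\<lambda>(j, i). if j < d - 1 then p (sorted_list_of_set \<sigma> ! i) j else 1)"

definition position :: "'a::linorder set \<Rightarrow> 'a \<Rightarrow> nat" where
  "position \<sigma> v = card {u \<in> \<sigma>. u < v}"

definition volume_rigidity_entry ::
  "nat \<Rightarrow> ('a::linorder \<Rightarrow> nat \<Rightarrow> real) \<Rightarrow> 'a set \<Rightarrow> 'a \<Rightarrow> nat \<Rightarrow> real" where
  "volume_rigidity_entry d p \<sigma> v j =
     (if v \<in> \<sigma> then cofactor (face_mat d p \<sigma>) j (position \<sigma> v) else 0)"

text \<open>The order of the columns is left unspecified; it does not affect the rank.\<close>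

definition face_list :: "nat \<Rightarrow> 'a set set \<Rightarrow> 'a set list" where
  "face_list d K = (SOME fs. distinct fs \<and> set fs = top_faces d K)"

text \<open>Row \<open>(d-1) * i + j\<close> with \<open>j < d - 1\<close> is the \<open>j\<close>-th row in the block of the \<open>i\<close>-th vertex.\<close>

definition volume_rigidity_mat ::
  "nat \<Rightarrow> 'a::linorder set set \<Rightarrow> ('a \<Rightarrow> nat \<Rightarrow> real) \<Rightarrow> real mat" where
  "volume_rigidity_mat d K p =
     mat ((d - 1) * card (vertices K)) (card (top_faces d K))
       (\<lambda>(r, c). volume_rigidity_entry d p (face_list d K ! c)
          (sorted_list_of_set (vertices K) ! (r div (d - 1))) (r mod (d - 1)))"

definition mat_rank :: "'a::field mat \<Rightarrow> nat" where
  "mat_rank A = vec_space.rank (dim_row A) A"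

text \<open>
  The rank is the same for all generic placements. With the existential quantifier below,
  \<open>\<not> volume_rigid d K\<close> says that no generic placement attains the required rank.
\<close>

definition volume_rigid :: "nat \<Rightarrow> 'a::linorder set set \<Rightarrow> bool" where
  "volume_rigid d K \<longleftrightarrow>
     (\<exists>p. generic d K p \<and>
        int (mat_rank (volume_rigidity_mat d K p)) =
          (int d - 1) * int (card (vertices K)) - ((int d)\<^sup>2 - int d - 1))"

end

theory Submission
  imports Defs
begin

text \<open>
  The obstruction is a stress (a linear dependency between the columns of the rigidity matrix)
  that the sparsity count does not see. Join the complete bipartite graph \<open>K\<^sub>3\<^sub>,\<^sub>3\<close> on
  \<open>{0, 1, 2} \<union> {3, 4, 5}\<close> with a simplex on \<open>d - 2\<close> further vertices, the spine. Project along
  the affine hull of the spine to the plane: up to a common factor, the volume of the face spanned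
  by the edge \<open>ab\<close> and the spine becomes the determinant of the images of \<open>a\<close> and \<open>b\<close>. Three
  vectors in the plane satisfy a linear relation, say with coefficients \<open>\<alpha>\<close> for \<open>0, 1, 2\<close> and
  \<open>\<beta>\<close> for \<open>3, 4, 5\<close>, and then \<open>\<alpha> a * \<beta> b\<close> is a stress on the nine faces. In terms of
  determinants: \<open>\<Sum>\<alpha> a a\<close> and \<open>\<Sum>\<beta> b b\<close> lie in the span of the spine, so every determinant
  that appears in the balance condition has two equal columns after expansion. This is
  \<open>product_stress_balanced\<close>.

  On the other hand \<open>K\<^sub>3\<^sub>,\<^sub>3\<close> has \<open>9 = 2 * 6 - 3\<close> edges, and any \<open>m \<ge> 2\<close> of its vertices span at
  most \<open>2 * m - 3\<close> edges. For \<open>d = 3\<close>, where the spine is a single vertex, this says that the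
  nine faces form a tight complex. Passing from \<open>d\<close> to \<open>d + 1\<close>, a cone over a tight complex with
  \<open>n\<close> vertices is sparse but lacks \<open>n - d\<close> faces; adding the faces spanned by \<open>d\<close> fixed old
  vertices and one more old vertex restores tightness (\<open>facets_sparse\<close>). The number of vertices
  beyond \<open>d\<close> is always four, and iterated coning makes the spine grow with \<open>d\<close>.

  A tight complex has exactly as many top faces as the rank that rigidity demands, so a single
  nontrivial stress refutes rigidity. Genericity only serves to find the relations \<open>\<alpha>\<close> and \<open>\<beta>\<close>
  with a nonzero coefficient: each of the pairs \<open>{0, 1}\<close> and \<open>{3, 4}\<close> must span a nonzero volume
  with the spine, which holds because distinct Leibniz terms of such a determinant are distinct
  monomials.
\<close>

section \<open>Determinants as functions of their columns\<close>

text \<open>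
  Columns come first in the argument \<open>c\<close>, so that replacing one column of the determinant is a
  function update.
\<close>

definition column_det :: "nat \<Rightarrow> (nat \<Rightarrow> nat \<Rightarrow> real) \<Rightarrow> real" where
  "column_det n c = det (mat n n (\<lambda>(r, i). c i r))"

lemma column_det_cong:
  assumes "\<And>i r. i < n \<Longrightarrow> r < n \<Longrightarrow> c i r = c' i r"
  shows "column_det n c = column_det n c'"
  unfolding column_det_def by (rule arg_cong[of _ _ det], rule eq_matI) (auto simp: assms)

lemma column_det_repeat:
  assumes "i < n" "k < n" "i \<noteq> k" "c i = c k"
  shows "column_det n c = 0"
proof -
  have "col (mat n n (\<lambda>(r, i). c i r)) i = col (mat n n (\<lambda>(r, i). c i r)) k"
    using assms by (intro eq_vecI) auto
  then show ?thesis
    unfolding column_det_def using assms det_identical_columns[of _ n i k] by (metis mat_carrier)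
qed

text \<open>
  Laplace expansion along the replaced column: its cofactors do not see the new entries, which
  makes the determinant visibly linear in that column.
\<close>

lemma column_det_expand:
  assumes "k < n"
  shows "column_det n (c(k := y)) = (\<Sum>r<n. y r * cofactor (mat n n (\<lambda>(r, i). c i r)) r k)"
proof -
  let ?M = "mat n n (\<lambda>(r, i). c i r)" and ?N = "mat n n (\<lambda>(r, i). (c(k := y)) i r)"
  have "cofactor ?N r k = cofactor ?M r k" if "r < n" for r
    unfolding cofactor_def mat_delete_def
    by (rule arg_cong[of _ _ "\<lambda>A. (-1) ^ (r + k) * det A"], rule eq_matI) (use that assms in auto)
  then show ?thesis
    unfolding column_det_def using laplace_expansion_column[of ?N n k] assms by simp
qed

lemma cofactor_eq_column_det:
  assumes "j < n" "k < n"
  shows "cofactor (mat n n (\<lambda>(r, i). c i r)) j k = column_det n (c(k := \<lambda>r. of_bool (r = j)))"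
  unfolding column_det_expand[OF assms(2)] using assms(1)
  by (simp add: of_bool_def if_distrib[of "\<lambda>x. x * _"] sum.delta cong: if_cong)

lemma column_det_sum:
  assumes "k < n" "\<And>r. r < n \<Longrightarrow> y r = (\<Sum>i\<in>I. t i * u i r)"
  shows "column_det n (c(k := y)) = (\<Sum>i\<in>I. t i * column_det n (c(k := u i)))"
  unfolding column_det_expand[OF assms(1)] sum_distrib_left
  by (subst sum.swap) (simp add: assms(2) sum_distrib_right mult.assoc)

text \<open>
  The coefficients are the solution of a linear system with invertible matrix.
\<close>

lemma column_det_nonzero_spans:
  assumes "column_det n c \<noteq> 0"
  shows "\<exists>t. \<forall>r<n. x r = (\<Sum>i<n. t i * c i r)"
proof -
  let ?M = "mat n n (\<lambda>(r, i). c i r)"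
  have "?M \<in> Units (ring_mat TYPE(real) n ())"
    using det_non_zero_imp_unit[of ?M n] assms unfolding column_det_def by simp
  then obtain N where N: "N \<in> carrier_mat n n" "?M * N = 1\<^sub>m n"
    unfolding Units_def ring_mat_def by auto
  define y where "y = N *\<^sub>v vec n x"
  have y: "y \<in> carrier_vec n" using N unfolding y_def by auto
  have "?M *\<^sub>v y = (?M * N) *\<^sub>v vec n x"
    unfolding y_def using N by (intro assoc_mult_mat_vec[symmetric, of _ n n _ n]) auto
  then have eq: "?M *\<^sub>v y = vec n x" using N by simp
  have "x r = (\<Sum>i<n. y $ i * c i r)" if "r < n" for r
  proof -
    have "x r = (?M *\<^sub>v y) $ r" using eq that by simp
    also have "\<dots> = (\<Sum>i<n. c i r * y $ i)"
      using that y by (simp add: scalar_prod_def lessThan_atLeast0)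
    finally show ?thesis by (simp add: mult.commute)
  qed
  then show ?thesis by blast
qed

section \<open>Stresses bound the rank\<close>

text \<open>
  The rank is the size of a maximal independent set of columns. As a set, the columns forget
  repetitions; if that size is the number of columns, then the columns are distinct and
  independent, and the kernel is trivial.
\<close>

lemma rank_less_if_kernel:
  fixes A :: "'a :: field mat"
  assumes A: "A \<in> carrier_mat n nc" and v: "v \<in> carrier_vec nc" "v \<noteq> 0\<^sub>v nc" "A *\<^sub>v v = 0\<^sub>v n"
  shows "mat_rank A < nc"
proof -
  interpret vec_space "TYPE('a)" n .
  obtain S where S: "maximal S (\<lambda>T. T \<subseteq> set (cols A) \<and> lin_indpt T)"
    using maximal_exists[of "(\<lambda>T. T \<subseteq> set (cols A) \<and> lin_indpt T)" "card (set (cols A))" "{}"]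
    by (meson List.finite_set card_mono empty_iff empty_subsetI finite_lin_indpt2 rev_finite_subset)
  then have sub: "S \<subseteq> set (cols A)" "lin_indpt S" unfolding maximal_def by auto
  have len: "length (cols A) = nc" using A by simp
  have le: "card S \<le> card (set (cols A))" "card (set (cols A)) \<le> nc"
    using sub(1) card_length[of "cols A"] len by (auto intro: card_mono)
  have "card S \<noteq> nc"
  proof
    assume "card S = nc"
    then have "card S = card (set (cols A))" "card (set (cols A)) = nc" using le by auto
    then have "S = set (cols A)" "distinct (cols A)"
      using sub(1) len by (auto simp: card_subset_eq intro: card_distinct)
    then show False using lin_depI[OF A v] sub(2) by blast
  qed
  moreover have "mat_rank A = card S"
    unfolding mat_rank_def using rank_card_indpt[OF A S] A by simp
  ultimately show ?thesis using le by simp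
qed

text \<open>
  The balance condition at \<open>v\<close> and \<open>j\<close> is the row of the equation that sends the weights
  \<open>\<omega>\<close>, listed in the order of the columns, to zero.
\<close>

lemma rank_less_if_stress:
  fixes K :: "'a::linorder set set"
  assumes fin: "finite K" "finite (vertices K)" and d: "d \<ge> 2"
    and bal: "\<And>v j. v \<in> vertices K \<Longrightarrow> j < d - 1 \<Longrightarrow>
      (\<Sum>\<sigma>\<in>top_faces d K. \<omega> \<sigma> * volume_rigidity_entry d p \<sigma> v j) = 0"
    and nz: "\<sigma>\<^sub>0 \<in> top_faces d K" "\<omega> \<sigma>\<^sub>0 \<noteq> 0"
  shows "mat_rank (volume_rigidity_mat d K p) < card (top_faces d K)"
proof -
  let ?fs = "face_list d K" and ?V = "volume_rigidity_mat d K p"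
  let ?n = "card (vertices K)" and ?f = "card (top_faces d K)"
  have "finite (top_faces d K)" using fin unfolding top_faces_def by simp
  then have "\<exists>fs. distinct fs \<and> set fs = top_faces d K" by (metis finite_distinct_list)
  then have fs: "distinct ?fs" "set ?fs = top_faces d K"
    unfolding face_list_def by (metis (mono_tags, lifting) someI_ex)+
  then have len: "length ?fs = ?f" using distinct_card by fastforce
  let ?w = "vec ?f (\<lambda>c. \<omega> (?fs ! c))"
  have V: "?V \<in> carrier_mat ((d - 1) * ?n) ?f" unfolding volume_rigidity_mat_def by simp
  have "?w \<noteq> 0\<^sub>v ?f"
  proof -
    obtain c where "c < ?f" "?fs ! c = \<sigma>\<^sub>0" using nz(1) fs len by (metis in_set_conv_nth)
    then have "?w $ c \<noteq> 0\<^sub>v ?f $ c" using nz(2) by simp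
    then show ?thesis by metis
  qed
  moreover have "?V *\<^sub>v ?w = 0\<^sub>v ((d - 1) * ?n)"
  proof (rule eq_vecI)
    fix r assume "r < dim_vec (0\<^sub>v ((d - 1) * ?n) :: real vec)"
    then have r: "r < (d - 1) * ?n" by simp
    define v j where "v = sorted_list_of_set (vertices K) ! (r div (d - 1))" and "j = r mod (d - 1)"
    have "r div (d - 1) < ?n" using r by (simp add: less_mult_imp_div_less mult.commute)
    then have v: "v \<in> vertices K" unfolding v_def using fin(2)
      by (metis length_sorted_list_of_set nth_mem set_sorted_list_of_set)
    have j: "j < d - 1" unfolding j_def using d by simp
    have "(?V *\<^sub>v ?w) $ r = (\<Sum>c = 0..<?f. ?V $$ (r, c) * \<omega> (?fs ! c))"
      using r V unfolding scalar_prod_def by (auto simp: scalar_prod_def)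
    also have "\<dots> = (\<Sum>c = 0..<?f. \<omega> (?fs ! c) * volume_rigidity_entry d p (?fs ! c) v j)"
      using r by (intro sum.cong) (auto simp: volume_rigidity_mat_def v_def j_def)
    also have "\<dots> = (\<Sum>\<sigma>\<in>set ?fs. \<omega> \<sigma> * volume_rigidity_entry d p \<sigma> v j)"
      using fs(1) len
      by (simp add: sum.distinct_set_conv_list sum_list_sum_nth)
    also have "\<dots> = 0" using bal[OF v j] fs(2) by simp
    finally show "(?V *\<^sub>v ?w) $ r = 0\<^sub>v ((d - 1) * ?n) $ r" using r by simp
  qed (use V in simp)
  ultimately show ?thesis using rank_less_if_kernel[OF V, of ?w] by auto
qed

section \<open>Generic points are affinely independent\<close>

definition homogeneous :: "nat \<Rightarrow> ('a \<Rightarrow> nat \<Rightarrow> real) \<Rightarrow> 'a \<Rightarrow> nat \<Rightarrow> real" where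
  "homogeneous d p v = (\<lambda>r. if r < d - 1 then p v r else 1)"

text \<open>
  The sum is the value of a polynomial whose monomials are the squarefree monomials with supports
  \<open>S t\<close>; they are pairwise distinct, so no coefficient \<open>c t\<close> can cancel.
\<close>

lemma squarefree_sum_nonzero:
  assumes indep: "alg_independent_over_rat x I" and fin: "finite T"
    and inj: "inj_on S T" and S: "\<And>t. t \<in> T \<Longrightarrow> finite (S t) \<and> S t \<subseteq> I"
    and ne: "\<exists>t\<in>T. c t \<noteq> 0"
  shows "(\<Sum>t\<in>T. of_rat (c t) * (\<Prod>i\<in>S t. x i)) \<noteq> 0"
proof
  define m :: "'b \<Rightarrow> ('a \<Rightarrow>\<^sub>0 nat)" where "m t = (\<Sum>i\<in>S t. Poly_Mapping.single i 1)" for t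
  define P where "P = (\<Sum>t\<in>T. Poly_Mapping.single (m t) (c t))"
  have lm: "Poly_Mapping.lookup (m t) i = of_bool (i \<in> S t)" if "t \<in> T" for t i
    using S[OF that] unfolding m_def lookup_sum lookup_single
    by (simp add: when_def)
  have km: "Poly_Mapping.keys (m t) = S t" if "t \<in> T" for t
    unfolding Poly_Mapping.keys.rep_eq using lm[OF that] by auto
  have injm: "inj_on m T" using inj km by (metis (no_types, lifting) inj_on_def)
  have lP: "Poly_Mapping.lookup P (m t) = c t" if t: "t \<in> T" for t
  proof -
    have "Poly_Mapping.lookup P (m t) = (\<Sum>s\<in>T. c s when m s = m t)"
      unfolding P_def lookup_sum lookup_single ..
    also have "\<dots> = (\<Sum>s\<in>T. if s = t then c s else 0)"
      using injm t by (intro sum.cong) (auto simp: when_def inj_on_def)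
    finally show ?thesis using t fin by simp
  qed
  have kP: "Poly_Mapping.keys P \<subseteq> m ` T"
    unfolding P_def using keys_sum[of "\<lambda>t. Poly_Mapping.single (m t) (c t)" T] by (auto split: if_splits)
  have "eval_poly x P = (\<Sum>q\<in>m ` T. of_rat (Poly_Mapping.lookup P q) *
      (\<Prod>i\<in>Poly_Mapping.keys q. x i ^ Poly_Mapping.lookup q i))"
    unfolding eval_poly_def using fin kP by (intro sum.mono_neutral_left) (auto simp: in_keys_iff)
  also have "\<dots> = (\<Sum>t\<in>T. of_rat (c t) * (\<Prod>i\<in>S t. x i))"
    using injm by (simp add: sum.reindex lP km lm)
  also assume "\<dots> = 0"
  finally have "P = 0"
    using indep kP km S unfolding alg_independent_over_rat_def by blast
  then show False using ne lP by force
qed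

text \<open>
  The last row of the matrix is constant, so the Leibniz term of a permutation \<open>\<pi>\<close> is the
  monomial in the coordinates \<open>(f (\<pi> r), r)\<close> with \<open>r < d - 1\<close>. The value of \<open>\<pi>\<close> at \<open>d - 1\<close> is
  determined by the others, so different permutations give different monomials.
\<close>

lemma generic_column_det_nonzero:
  assumes gen: "generic d K p" and d: "d > 0"
    and f: "inj_on f {..<d}" "f ` {..<d} \<subseteq> vertices K"
  shows "column_det d (\<lambda>i. homogeneous d p (f i)) \<noteq> 0"
proof -
  let ?T = "{\<pi>. \<pi> permutes {0..<d}}" and ?x = "\<lambda>(v, j). p v j"
  define S where "S \<pi> = (\<lambda>r. (f (\<pi> r), r)) ` {..<d - 1}" for \<pi>
  have "inj_on S ?T"
  proof (rule inj_onI, rule ext)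
    fix \<pi> \<rho> r assume pr: "\<pi> \<in> ?T" "\<rho> \<in> ?T" and eq: "S \<pi> = S \<rho>"
    have less: "\<pi> s = \<rho> s" if s: "s < d - 1" for s
    proof -
      have "(f (\<pi> s), s) \<in> S \<rho>" using s eq unfolding S_def by blast
      then have "f (\<pi> s) = f (\<rho> s)" unfolding S_def by auto
      then show ?thesis
        using f(1) pr s permutes_in_image[of _ "{0..<d}" s] by (auto simp: inj_on_def)
    qed
    show "\<pi> r = \<rho> r"
    proof (cases "r = d - 1")
      case True
      have "\<pi> ` {0..<d} = {0..<d}" "\<rho> ` {0..<d} = {0..<d}" "inj \<pi>" "inj \<rho>"
        using pr by (auto simp: permutes_image permutes_inj)
      moreover have "{0..<d} = insert (d - 1) {0..<d - 1}" using d by auto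
      moreover have "\<pi> ` {0..<d - 1} = \<rho> ` {0..<d - 1}" using less by (intro image_cong) auto
      moreover have "\<pi> (d - 1) \<notin> \<pi> ` {0..<d - 1}" "\<rho> (d - 1) \<notin> \<rho> ` {0..<d - 1}"
        using calculation(3,4) by (auto simp: inj_eq)
      ultimately show ?thesis unfolding True by (metis image_insert insert_ident insert_iff)
    next
      case False
      then show ?thesis
        using less[of r] pr permutes_not_in[of \<pi> "{0..<d}" r] permutes_not_in[of \<rho> "{0..<d}" r]
        by (cases "r < d") auto
    qed
  qed
  moreover have "S \<pi> \<subseteq> vertices K \<times> {..<d - 1}" if "\<pi> \<in> ?T" for \<pi>
    using that f(2) permutes_in_image[of \<pi> "{0..<d}"] unfolding S_def by fastforce
  moreover have "finite (S \<pi>)" for \<pi> unfolding S_def by simp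
  ultimately have "(\<Sum>\<pi>\<in>?T. of_rat (of_int (sign \<pi>)) * (\<Prod>i\<in>S \<pi>. ?x i)) \<noteq> 0"
    using gen unfolding generic_def
    by (intro squarefree_sum_nonzero[where I = "vertices K \<times> {..<d - 1}"])
      (auto simp: finite_permutations sign_def intro: permutes_id)
  moreover have "column_det d (\<lambda>i. homogeneous d p (f i)) =
      (\<Sum>\<pi>\<in>?T. of_rat (of_int (sign \<pi>)) * (\<Prod>i\<in>S \<pi>. ?x i))"
  proof -
    have "(\<Prod>r = 0..<d. homogeneous d p (f (\<pi> r)) r) = (\<Prod>i\<in>S \<pi>. ?x i)" for \<pi>
    proof -
      have "inj_on (\<lambda>r. (f (\<pi> r), r)) {..<d - 1}" by (auto simp: inj_on_def)
      then have "(\<Prod>i\<in>S \<pi>. ?x i) = (\<Prod>r<d - 1. p (f (\<pi> r)) r)"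
        unfolding S_def by (simp add: prod.reindex)
      moreover have "{0..<d} = insert (d - 1) {..<d - 1}" using d by auto
      ultimately show ?thesis by (simp add: homogeneous_def)
    qed
    moreover have "mat d d (\<lambda>(r, i). homogeneous d p (f i) r) $$ (r, \<pi> r) = homogeneous d p (f (\<pi> r)) r"
      if "\<pi> \<in> ?T" "r \<in> {0..<d}" for \<pi> r
      using that permutes_in_image[of \<pi> "{0..<d}" r] by auto
    ultimately show ?thesis
      unfolding column_det_def by (subst det_def'[of _ d]) (auto intro!: sum.cong prod.cong)
  qed
  ultimately show ?thesis by simp
qed

section \<open>A tight complex containing the join of \<open>K\<^sub>3\<^sub>,\<^sub>3\<close> with a simplex\<close>

text \<open>
  The join of an edge of \<open>K\<^sub>3\<^sub>,\<^sub>3\<close> with the spine \<open>{6..<d + 4}\<close>. Numbering the spine last makes the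
  increasing order of every flap uniform: first \<open>a\<close>, then \<open>b\<close>, then the spine. Hence no signs
  arise when the face matrices of different flaps are compared.
\<close>

definition flap :: "nat \<Rightarrow> nat \<Rightarrow> nat \<Rightarrow> nat set" where
  "flap d a b = insert a (insert b {6..<d + 4})"

text \<open>
  The facets for \<open>d = k + 3\<close>, on the \<open>d + 4\<close> vertices \<open>{..<k + 7}\<close>. The recursive step is a cone
  with apex \<open>k + 7\<close> together with the four faces that the cone lacks for tightness.
\<close>

fun facets :: "nat \<Rightarrow> nat set set" where
  "facets 0 = (\<lambda>(a, b). flap 3 a b) ` ({..<3} \<times> {3..<6})"
| "facets (Suc k) = insert (k + 7) ` facets k \<union> (\<lambda>i. insert i {..<k + 3}) ` {k + 3..<k + 7}"

lemma flap_3: "flap 3 a b = {a, b, 6}"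
proof -
  have "{6..<3 + 4 :: nat} = {6}" by auto
  then show ?thesis unfolding flap_def by simp
qed

lemma facets_subset: "\<sigma> \<in> facets k \<Longrightarrow> \<sigma> \<subseteq> {..<k + 7}"
  by (induction k arbitrary: \<sigma>) (fastforce simp: flap_def)+

lemma finite_facets: "finite (facets k)"
  by (induction k) auto

lemma card_facet: "\<sigma> \<in> facets k \<Longrightarrow> card \<sigma> = k + 3"
proof (induction k arbitrary: \<sigma>)
  case 0
  then obtain a b where "a < 3" "3 \<le> b" "b < 6" "\<sigma> = flap 3 a b" by auto
  then show ?case by (auto simp: flap_3)
next
  case (Suc k)
  from Suc.prems consider \<tau> where "\<tau> \<in> facets k" "\<sigma> = insert (k + 7) \<tau>"
    | i where "i \<ge> k + 3" "\<sigma> = insert i {..<k + 3}" by auto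
  then show ?case
  proof cases
    case 1
    then have "k + 7 \<notin> \<tau>" "finite \<tau>" using facets_subset[of \<tau> k] by (auto intro: finite_subset)
    then show ?thesis using 1 Suc.IH by simp
  qed auto
qed

lemma flap_in_facets:
  assumes "a < 3" "3 \<le> b" "b < 6"
  shows "flap (k + 3) a b \<in> facets k"
proof (induction k)
  case 0
  show ?case using assms by force
next
  case (Suc k)
  have "flap (Suc k + 3) a b = insert (k + 7) (flap (k + 3) a b)" unfolding flap_def by auto
  then show ?case using Suc by simp
qed

lemma Union_facets: "\<Union> (facets k) = {..<k + 7}"
proof (induction k)
  case 0
  have "x \<in> \<Union> (facets 0)" if "x < 7" for x
  proof -
    have "x < 3 \<or> 3 \<le> x \<and> x < 6 \<or> x = 6" using that by linarith
    then have "x \<in> flap 3 x 3 \<and> x < 3 \<or> x \<in> flap 3 0 x \<and> 3 \<le> x \<and> x < 6 \<or> x \<in> flap 3 0 3"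
      by (auto simp: flap_3)
    then show ?thesis
      using flap_in_facets[of x 3 0] flap_in_facets[of 0 x 0] flap_in_facets[of 0 3 0]
      by (auto simp del: facets.simps)
  qed
  then show ?case using facets_subset[of _ 0] by auto
next
  case (Suc k)
  have "facets k \<noteq> {}" using flap_in_facets[of 0 3 k] by auto
  then have "\<Union> (insert (k + 7) ` facets k) = insert (k + 7) (\<Union> (facets k))" by auto
  then have "{..<Suc k + 7} \<subseteq> \<Union> (facets (Suc k))" unfolding Suc by auto
  then show ?case using facets_subset[of _ "Suc k"] by blast
qed

lemma inj_on_flap: "inj_on (\<lambda>(a, b). flap d a b) ({..<3} \<times> {3..<6})"
  by (rule inj_onI) (auto simp: flap_def set_eq_iff; metis One_nat_def leD less_trans)+

lemma card_facets: "card (facets k) = 4 * k + 9"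
proof (induction k)
  case 0
  show ?case by (simp add: card_image inj_on_flap)
next
  case (Suc k)
  have notin: "k + 7 \<notin> \<sigma>" if "\<sigma> \<in> facets k" for \<sigma> using facets_subset[OF that] by auto
  have "inj_on (insert (k + 7)) (facets k)"
    using notin by (auto simp: inj_on_def insert_ident)
  moreover have "inj_on (\<lambda>i. insert i {..<k + 3}) {k + 3..<k + 7}"
    by (auto simp: inj_on_def set_eq_iff)
  moreover have "insert (k + 7) ` facets k \<inter> (\<lambda>i. insert i {..<k + 3}) ` {k + 3..<k + 7} = {}"
  proof -
    have "\<forall>\<sigma> \<in> insert (k + 7) ` facets k. k + 7 \<in> \<sigma>"
      "\<forall>\<sigma> \<in> (\<lambda>i. insert i {..<k + 3}) ` {k + 3..<k + 7}. k + 7 \<notin> \<sigma>" by auto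
    then show ?thesis by blast
  qed
  ultimately show ?case
    using Suc by (simp add: card_Un_disjoint finite_facets card_image)
qed

text \<open>
  With \<open>d = k + 3\<close>, the constant \<open>k * k + 5 * k + 5\<close> is \<open>d\<^sup>2 - d - 1\<close>. In the base case, a set with
  \<open>i\<close> and \<open>j\<close> vertices on the two sides of \<open>K\<^sub>3\<^sub>,\<^sub>3\<close> and the spine vertex contains \<open>i * j\<close> faces, and
  \<open>i * j \<le> 2 * (i + j) - 3\<close>, that is \<open>(i - 2) * (j - 2) \<le> 1\<close>, holds because \<open>i\<close> and \<open>j\<close> are at most
  \<open>3\<close> with sum at least \<open>2\<close>. In the step, let \<open>B\<close> be the set
  without the apex. The additional faces inside \<open>B\<close> number at most \<open>card B - d\<close>. If the apex is
  present, this is exactly the slack that coning leaves over the induction hypothesis for \<open>B\<close>;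
  if it is absent, the additional faces are the only ones.
\<close>

lemma facets_sparse:
  assumes "A \<subseteq> {..<k + 7}" "k + 3 \<le> card A"
  shows "card {\<sigma> \<in> facets k. \<sigma> \<subseteq> A} + (k * k + 5 * k + 5) \<le> (k + 2) * card A"
  using assms
proof (induction k arbitrary: A)
  case 0
  define i j where "i = card (A \<inter> {..<3})" and "j = card (A \<inter> {3..<6})"
  have fin: "finite A" using 0 by (auto intro: finite_subset)
  have ij: "i \<le> 3" "j \<le> 3"
    using card_mono[of "{..<3}" "A \<inter> {..<3}"] card_mono[of "{3..<6}" "A \<inter> {3..<6}"]
    unfolding i_def j_def by auto
  have "A = (A \<inter> {..<3}) \<union> (A \<inter> {3..<6}) \<union> (A \<inter> {6})" using 0 by fastforce
  moreover have "card ((A \<inter> {..<3}) \<union> (A \<inter> {3..<6}) \<union> (A \<inter> {6})) = i + j + card (A \<inter> {6})"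
    unfolding i_def j_def using fin by (subst card_Un_disjoint; (subst card_Un_disjoint)?) auto
  ultimately have A: "card A = i + j + card (A \<inter> {6})" by simp
  show ?case
  proof (cases "6 \<in> A")
    case True
    have "{\<sigma> \<in> facets 0. \<sigma> \<subseteq> A} \<subseteq> (\<lambda>(a, b). flap 3 a b) ` ((A \<inter> {..<3}) \<times> (A \<inter> {3..<6}))"
    proof
      fix \<sigma> assume "\<sigma> \<in> {\<sigma> \<in> facets 0. \<sigma> \<subseteq> A}"
      then obtain a b where "a < 3" "3 \<le> b" "b < 6" "\<sigma> = flap 3 a b" "\<sigma> \<subseteq> A" by auto
      then have "(a, b) \<in> (A \<inter> {..<3}) \<times> (A \<inter> {3..<6})" by (auto simp: flap_def)
      then show "\<sigma> \<in> (\<lambda>(a, b). flap 3 a b) ` ((A \<inter> {..<3}) \<times> (A \<inter> {3..<6}))"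
        using \<open>\<sigma> = flap 3 a b\<close> by blast
    qed
    then have "card {\<sigma> \<in> facets 0. \<sigma> \<subseteq> A} \<le> card ((A \<inter> {..<3}) \<times> (A \<inter> {3..<6}))"
      using fin by (meson card_image_le card_mono finite_Int finite_SigmaI finite_imageI le_trans)
    then have "card {\<sigma> \<in> facets 0. \<sigma> \<subseteq> A} \<le> i * j"
      unfolding i_def j_def by (simp add: card_cartesian_product)
    moreover have "i + j \<ge> 2" "card A = i + j + 1" using True A 0 by auto
    moreover have "i * j + 3 \<le> 2 * (i + j)"
    proof -
      have "i \<in> {0,1,2,3}" "j \<in> {0,1,2,3}" using ij by auto
      then show ?thesis using \<open>i + j \<ge> 2\<close> by auto
    qed
    ultimately show ?thesis by simp
  next
    case False
    then have "{\<sigma> \<in> facets 0. \<sigma> \<subseteq> A} = {}" by (auto simp: flap_3)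
    then have "card {\<sigma> \<in> facets 0. \<sigma> \<subseteq> A} = 0" by (simp only: card.empty)
    then show ?thesis using 0(2) by (simp del: facets.simps)
  qed
next
  case (Suc k)
  define B where "B = A - {k + 7}"
  define X where "X = {\<sigma> \<in> facets k. \<sigma> \<subseteq> B}"
  define Y where "Y = {\<sigma> \<in> (\<lambda>i. insert i {..<k + 3}) ` {k + 3..<k + 7}. \<sigma> \<subseteq> B}"
  have fin: "finite A" "finite X" "finite Y"
    using Suc.prems finite_facets unfolding X_def Y_def by (auto intro: finite_subset)
  have B: "B \<subseteq> {..<k + 7}" "finite B" using Suc.prems fin unfolding B_def by auto
  \<comment> \<open>Each additional face needs the whole of \<open>{..<k + 3}\<close> and one vertex of its own.\<close>
  have Y: "card Y + (k + 3) \<le> card B" if "k + 3 \<le> card B"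
  proof (cases "{..<k + 3} \<subseteq> B")
    case True
    have "Y \<subseteq> (\<lambda>i. insert i {..<k + 3}) ` (B - {..<k + 3})" unfolding Y_def by auto
    then have "card Y \<le> card (B - {..<k + 3})"
      using B(2) by (meson card_image_le card_mono finite_Diff finite_imageI le_trans)
    then show ?thesis using that True by (simp add: card_Diff_subset)
  next
    case False
    then have "Y = {}" unfolding Y_def by auto
    then show ?thesis using that by simp
  qed
  have split: "{\<sigma> \<in> facets (Suc k). \<sigma> \<subseteq> A} \<subseteq> (if k + 7 \<in> A then insert (k + 7) ` X else {}) \<union> Y"
  proof
    fix \<sigma> assume \<sigma>: "\<sigma> \<in> {\<sigma> \<in> facets (Suc k). \<sigma> \<subseteq> A}"
    then consider \<tau> where "\<tau> \<in> facets k" "\<sigma> = insert (k + 7) \<tau>"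
      | i where "i \<in> {k + 3..<k + 7}" "\<sigma> = insert i {..<k + 3}" by auto
    then show "\<sigma> \<in> (if k + 7 \<in> A then insert (k + 7) ` X else {}) \<union> Y"
    proof cases
      case 1
      then have "\<tau> \<in> X" "k + 7 \<in> A" using \<sigma> facets_subset[of \<tau> k] unfolding X_def B_def by auto
      then show ?thesis using 1 by simp
    next
      case 2
      then have "\<sigma> \<subseteq> B" using \<sigma> unfolding B_def by auto
      then show ?thesis using 2 unfolding Y_def by auto
    qed
  qed
  show ?case
  proof (cases "k + 7 \<in> A")
    case True
    then have A: "card A = card B + 1" unfolding B_def using fin
      by (metis Suc_eq_plus1 card.remove)
    have "card {\<sigma> \<in> facets (Suc k). \<sigma> \<subseteq> A} \<le> card (insert (k + 7) ` X \<union> Y)"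
      using split True fin by (intro card_mono) auto
    also have "\<dots> \<le> card X + card Y"
      using fin by (meson add_le_mono1 card_Un_le card_image_le le_trans)
    finally have "card {\<sigma> \<in> facets (Suc k). \<sigma> \<subseteq> A} \<le> card X + card Y" .
    moreover have "card X + (k * k + 5 * k + 5) \<le> (k + 2) * card B"
      using Suc.IH[OF B(1)] A Suc.prems unfolding X_def by simp
    moreover have "card Y + (k + 3) \<le> card B" using Y A Suc.prems by simp
    ultimately show ?thesis unfolding A by (simp add: algebra_simps)
  next
    case False
    then have A: "B = A" unfolding B_def by simp
    have "card {\<sigma> \<in> facets (Suc k). \<sigma> \<subseteq> A} \<le> card Y"
      using split False fin by (intro card_mono) auto
    moreover have "card Y + (k + 3) \<le> card A" using Y A Suc.prems by simp
    moreover have "(k + 2) * (k + 4) \<le> (k + 2) * card A"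
      using Suc.prems by (intro mult_le_mono2) simp
    ultimately show ?thesis by (simp add: algebra_simps)
  qed
qed

definition facet_complex :: "nat \<Rightarrow> nat set set" where
  "facet_complex k = {\<tau>. \<exists>\<sigma>\<in>facets k. \<tau> \<subseteq> \<sigma>}"

lemma facet_complex_subset: "facet_complex k \<subseteq> Pow {..<k + 7}"
  unfolding facet_complex_def using facets_subset by fast

lemma abstract_facet_complex: "abstract_complex (facet_complex k)"
  unfolding abstract_complex_def
proof (intro conjI ballI allI impI)
  show "facet_complex k \<noteq> {}"
    unfolding facet_complex_def using flap_in_facets[of 0 3 k] by fastforce
  show "finite (facet_complex k)" using facet_complex_subset by (rule finite_subset) simp
  show "finite \<sigma>" if "\<sigma> \<in> facet_complex k" for \<sigma>
    using that facet_complex_subset by (auto intro: finite_subset[of _ "{..<k + 7}"])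
  show "\<tau> \<in> facet_complex k" if "\<sigma> \<in> facet_complex k" "\<tau> \<subseteq> \<sigma>" for \<sigma> \<tau>
    using that unfolding facet_complex_def by auto
qed

lemma vertices_facet_complex: "vertices (facet_complex k) = {..<k + 7}"
proof -
  have "\<Union> (facet_complex k) = \<Union> (facets k)" unfolding facet_complex_def by blast
  then show ?thesis unfolding vertices_def Union_facets .
qed

lemma card_face_le:
  assumes "\<sigma> \<in> facets k" "\<tau> \<subseteq> \<sigma>"
  shows "card \<tau> \<le> k + 3" and "card \<tau> = k + 3 \<Longrightarrow> \<tau> = \<sigma>"
proof -
  have "finite \<sigma>" using card_facet[OF assms(1)] by (auto intro: card_ge_0_finite)
  then show "card \<tau> \<le> k + 3" "card \<tau> = k + 3 \<Longrightarrow> \<tau> = \<sigma>"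
    using card_facet[OF assms(1)] assms(2) by (auto dest: card_mono card_subset_eq)
qed

text \<open>
  All facets have the same cardinality, so none is properly contained in another.
\<close>

lemma top_faces_facet_complex: "top_faces (k + 3) (facet_complex k) = facets k"
  unfolding top_faces_def facet_complex_def using card_facet card_face_le(2) by blast

lemma dim_facet_complex: "complex_dim (facet_complex k) = int (k + 3) - 1"
  unfolding complex_dim_def
proof (rule Max_eqI)
  show "finite ((\<lambda>\<sigma>. int (card \<sigma>) - 1) ` facet_complex k)"
    using abstract_facet_complex unfolding abstract_complex_def by simp
  show "y \<le> int (k + 3) - 1" if y: "y \<in> (\<lambda>\<sigma>. int (card \<sigma>) - 1) ` facet_complex k" for y
  proof -
    obtain \<tau> \<sigma> where "y = int (card \<tau>) - 1" "\<sigma> \<in> facets k" "\<tau> \<subseteq> \<sigma>"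
      using y unfolding facet_complex_def by auto
    then show ?thesis using card_face_le(1)[of \<sigma> k \<tau>] by simp
  qed
  have "flap (k + 3) 0 3 \<in> facets k" by (rule flap_in_facets) auto
  then have "flap (k + 3) 0 3 \<in> facet_complex k" "card (flap (k + 3) 0 3) = k + 3"
    using card_facet unfolding facet_complex_def by auto
  then show "int (k + 3) - 1 \<in> (\<lambda>\<sigma>. int (card \<sigma>) - 1) ` facet_complex k" by force
qed

lemma tight_facet_complex:
  fixes k defines "d \<equiv> k + 3"
  shows "tight d (int d - 1) ((int d)\<^sup>2 - int d - 1) (facet_complex k)"
  unfolding tight_def sparse_def
proof (intro conjI allI impI)
  have d: "top_faces d (facet_complex k) = facets k"
    unfolding d_def by (rule top_faces_facet_complex)
  show "int (card {\<sigma> \<in> top_faces d (facet_complex k). \<sigma> \<subseteq> A}) \<le>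
      (int d - 1) * int (card A) - ((int d)\<^sup>2 - int d - 1)"
    if "A \<subseteq> vertices (facet_complex k) \<and> d \<le> card A" for A
  proof -
    have "int (card {\<sigma> \<in> facets k. \<sigma> \<subseteq> A} + (k * k + 5 * k + 5)) \<le> int ((k + 2) * card A)"
      using facets_sparse[of A k] that unfolding d_def vertices_facet_complex by (intro zle_int[THEN iffD2]) simp
    then show ?thesis unfolding d unfolding d_def by (simp add: power2_eq_square algebra_simps)
  qed
  show "int (card (top_faces d (facet_complex k))) =
      (int d - 1) * int (card (vertices (facet_complex k))) - ((int d)\<^sup>2 - int d - 1)"
    unfolding d vertices_facet_complex card_facets unfolding d_def
    by (simp add: power2_eq_square algebra_simps)
qed

section \<open>The product stress\<close>

text \<open>
  The columns of the face matrix of a flap, with an arbitrary vertex map \<open>h\<close> in place of the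
  homogeneous coordinates. Column \<open>i \<ge> 2\<close> holds the spine vertex \<open>i + 4\<close>.
\<close>

definition flap_columns :: "(nat \<Rightarrow> nat \<Rightarrow> real) \<Rightarrow> nat \<Rightarrow> nat \<Rightarrow> nat \<Rightarrow> nat \<Rightarrow> real" where
  "flap_columns h a b = (\<lambda>i. if i = 0 then h a else if i = 1 then h b else h (i + 4))"

lemma sorted_flap:
  assumes "a < b" "b < 6"
  shows "sorted_list_of_set (flap d a b) = a # b # [6..<d + 4]"
proof -
  have "flap d a b = set (a # b # [6..<d + 4])" unfolding flap_def by simp
  moreover have "sorted (a # b # [6..<d + 4])" "distinct (a # b # [6..<d + 4])"
    using assms by auto
  ultimately show ?thesis by (metis sorted_list_of_set.idem_if_sorted_distinct)
qed

lemma face_mat_flap: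
  assumes "a < b" "b < 6"
  shows "face_mat d p (flap d a b) = mat d d (\<lambda>(r, i). flap_columns (homogeneous d p) a b i r)"
  unfolding face_mat_def sorted_flap[OF assms]
  by (rule eq_matI) (auto simp: homogeneous_def flap_columns_def nth_Cons' nth_append add.commute)

lemma position_flap:
  assumes "a < b" "b < 6"
  shows "position (flap d a b) a = 0" "position (flap d a b) b = 1"
    and "\<lbrakk>6 \<le> v; v < d + 4\<rbrakk> \<Longrightarrow> position (flap d a b) v = v - 4"
proof -
  have "{u \<in> flap d a b. u < a} = {}" "{u \<in> flap d a b. u < b} = {a}"
    unfolding flap_def using assms by auto
  then show "position (flap d a b) a = 0" "position (flap d a b) b = 1"
    unfolding position_def by (metis card.empty, simp)
  assume v: "6 \<le> v" "v < d + 4"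
  then have "{u \<in> flap d a b. u < v} = insert a (insert b {6..<v})"
    unfolding flap_def using assms by auto
  then show "position (flap d a b) v = v - 4"
    unfolding position_def using assms v by simp
qed

text \<open>
  A cofactor is the determinant with its column replaced by a unit vector; this turns the entries
  of the rigidity matrix into values of the multilinear function \<open>column_det\<close>.
\<close>

lemma volume_rigidity_entry_flap:
  fixes d j defines "e \<equiv> \<lambda>r. of_bool (r = j)"
  assumes "a < b" "b < 6" "j < d - 1" "d \<ge> 2"
  shows "volume_rigidity_entry d p (flap d a b) a j
      = column_det d ((flap_columns (homogeneous d p) a b)(0 := e))"
    and "volume_rigidity_entry d p (flap d a b) b j
      = column_det d ((flap_columns (homogeneous d p) a b)(1 := e))"
    and "\<lbrakk>6 \<le> v; v < d + 4\<rbrakk> \<Longrightarrow> volume_rigidity_entry d p (flap d a b) v j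
      = column_det d ((flap_columns (homogeneous d p) a b)(v - 4 := e))"
proof -
  have *: "volume_rigidity_entry d p (flap d a b) u j
      = column_det d ((flap_columns (homogeneous d p) a b)(position (flap d a b) u := e))"
    if "u \<in> flap d a b" "position (flap d a b) u < d" for u
    using that assms(2-5) cofactor_eq_column_det[of j d]
    unfolding volume_rigidity_entry_def e_def by (simp add: face_mat_flap)
  show "volume_rigidity_entry d p (flap d a b) a j
      = column_det d ((flap_columns (homogeneous d p) a b)(0 := e))"
    using *[of a] position_flap(1)[OF assms(2,3)] assms(5) by (simp add: flap_def)
  show "volume_rigidity_entry d p (flap d a b) b j
      = column_det d ((flap_columns (homogeneous d p) a b)(1 := e))"
    using *[of b] position_flap(2)[OF assms(2,3)] assms(5) by (simp add: flap_def)
  show "volume_rigidity_entry d p (flap d a b) v j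
      = column_det d ((flap_columns (homogeneous d p) a b)(v - 4 := e))" if "6 \<le> v" "v < d + 4"
    using *[of v] position_flap(3)[OF assms(2,3) that] that by (simp add: flap_def)
qed

lemma column_det_span_zero:
  assumes "k < n" "I \<subseteq> {..<n} - {k}" "\<And>r. r < n \<Longrightarrow> y r = (\<Sum>i\<in>I. s i * c i r)"
  shows "column_det n (c(k := y)) = 0"
proof -
  have "column_det n (c(k := c i)) = 0" if "i \<in> I" for i
    using that assms(1,2) by (intro column_det_repeat[of i n k]) auto
  then show ?thesis using column_det_sum[OF assms(1), where y = y and I = I and t = s and u = c and c = c] assms(3)
    by simp
qed

text \<open>
  The vectors of \<open>u\<close>, \<open>u + 1\<close> and the spine form a basis. Expressing the vertex \<open>u + 2\<close> in it
  gives a relation in which the coefficient of \<open>u + 2\<close> is nonzero.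
\<close>

lemma triple_relation_modulo_spine:
  assumes "column_det d (flap_columns h u (u + 1)) \<noteq> 0" "d \<ge> 2"
  shows "\<exists>\<alpha> s. \<alpha> (u + 2) = -1 \<and>
    (\<forall>r<d. (\<Sum>a = u..<u + 3. \<alpha> a * h a r) = (\<Sum>i = 2..<d. s i * h (i + 4) r))"
proof -
  obtain t where t: "h (u + 2) r = (\<Sum>i<d. t i * flap_columns h u (u + 1) i r)" if "r < d" for r
    using column_det_nonzero_spans[OF assms(1)] by meson
  define \<alpha> where "\<alpha> a = (if a = u then t 0 else if a = u + 1 then t 1 else -1)" for a
  have "(\<Sum>a = u..<u + 3. \<alpha> a * h a r) = (\<Sum>i = 2..<d. - t i * h (i + 4) r)" if "r < d" for r
  proof -
    have "{..<d} = {0, 1} \<union> {2..<d}" using assms(2) by auto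
    then have "h (u + 2) r = t 0 * h u r + t 1 * h (u + 1) r + (\<Sum>i = 2..<d. t i * h (i + 4) r)"
      unfolding t[OF that] by (simp add: sum.union_disjoint flap_columns_def)
    moreover have "{u..<u + 3} = {u, u + 1, u + 2}" by auto
    ultimately show ?thesis by (simp add: \<alpha>_def sum_negf)
  qed
  then show ?thesis by (intro exI[of _ \<alpha>] exI[of _ "\<lambda>i. - t i"]) (simp add: \<alpha>_def)
qed

text \<open>
  Summing over the vertices of one side replaces the column of that side by a combination of spine
  vectors. Varying a vertex of \<open>K\<^sub>3\<^sub>,\<^sub>3\<close> (column \<open>0\<close> or \<open>1\<close>) leaves the whole spine in place, so the
  other of the two columns becomes dependent on it. Varying a spine vertex (column \<open>k\<close>) removes
  one spine vector, but then both columns \<open>0\<close> and \<open>1\<close> become combinations of spine vectors, and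
  the missing vector cannot fill both of them without repetition.
\<close>

lemma product_stress_balanced:
  fixes h :: "nat \<Rightarrow> nat \<Rightarrow> real"
  assumes \<alpha>: "\<And>r. r < d \<Longrightarrow> (\<Sum>a<3. \<alpha> a * h a r) = (\<Sum>i = 2..<d. s i * h (i + 4) r)"
    and \<beta>: "\<And>r. r < d \<Longrightarrow> (\<Sum>b = 3..<6. \<beta> b * h b r) = (\<Sum>i = 2..<d. t i * h (i + 4) r)"
    and d: "d \<ge> 2"
  shows "(\<Sum>a<3. \<alpha> a * column_det d ((flap_columns h a b)(1 := x))) = 0"
    and "(\<Sum>b = 3..<6. \<beta> b * column_det d ((flap_columns h a b)(0 := x))) = 0"
    and "\<lbrakk>2 \<le> k; k < d\<rbrakk> \<Longrightarrow>
      (\<Sum>a<3. \<Sum>b = 3..<6. \<alpha> a * \<beta> b * column_det d ((flap_columns h a b)(k := x))) = 0"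
proof -
  let ?A = "\<lambda>r. \<Sum>a<3. \<alpha> a * h a r" and ?B = "\<lambda>r. \<Sum>b = 3..<6. \<beta> b * h b r"
  let ?c = "\<lambda>k. (flap_columns h a b)(k := x)"
  have "(\<Sum>a<3. \<alpha> a * column_det d ((flap_columns h a b)(1 := x)))
      = (\<Sum>a<3. \<alpha> a * column_det d ((?c 1)(0 := h a)))"
    by (intro sum.cong arg_cong2[of _ _ _ _ "(*)"] column_det_cong) (auto simp: flap_columns_def)
  also have "\<dots> = column_det d ((?c 1)(0 := ?A))"
    using d by (intro column_det_sum[symmetric]) auto
  also have "\<dots> = 0"
    using d \<alpha> by (intro column_det_span_zero[where I = "{2..<d}" and s = s])
      (auto simp: flap_columns_def)
  finally show "(\<Sum>a<3. \<alpha> a * column_det d ((flap_columns h a b)(1 := x))) = 0" .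
  have "(\<Sum>b = 3..<6. \<beta> b * column_det d ((flap_columns h a b)(0 := x)))
      = (\<Sum>b = 3..<6. \<beta> b * column_det d ((?c 0)(1 := h b)))"
    by (intro sum.cong arg_cong2[of _ _ _ _ "(*)"] column_det_cong) (auto simp: flap_columns_def)
  also have "\<dots> = column_det d ((?c 0)(1 := ?B))"
    using d by (intro column_det_sum[symmetric]) auto
  also have "\<dots> = 0"
    using d \<beta> by (intro column_det_span_zero[where I = "{2..<d}" and s = t])
      (auto simp: flap_columns_def)
  finally show "(\<Sum>b = 3..<6. \<beta> b * column_det d ((flap_columns h a b)(0 := x))) = 0" .
  assume k: "2 \<le> k" "k < d"
  let ?g = "\<lambda>i. h (i + 4)"
  have vanish: "column_det d ((?c k)(0 := ?g i, 1 := ?g l)) = 0" if "i \<in> {2..<d}" "l \<in> {2..<d}" for i l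
  proof (cases "i = k")
    case False
    then show ?thesis
      using that k by (intro column_det_repeat[of 0 d i]) (auto simp: flap_columns_def)
  next
    case i: True
    show ?thesis
    proof (cases "l = k")
      case True
      then show ?thesis
        using i k by (intro column_det_repeat[of 0 d 1]) auto
    next
      case False
      then show ?thesis
        using that k by (intro column_det_repeat[of 1 d l]) (auto simp: flap_columns_def)
    qed
  qed
  have "(\<Sum>a<3. \<Sum>b = 3..<6. \<alpha> a * \<beta> b * column_det d ((flap_columns h a b)(k := x)))
      = (\<Sum>a<3. \<Sum>b = 3..<6. \<alpha> a * \<beta> b * column_det d ((?c k)(0 := h a, 1 := h b)))"
    using k by (intro sum.cong arg_cong2[of _ _ _ _ "(*)"] column_det_cong) (auto simp: flap_columns_def)
  also have "\<dots> = (\<Sum>a<3. \<alpha> a * column_det d ((?c k)(0 := h a, 1 := ?B)))"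
  proof (rule sum.cong)
    fix a'
    have "column_det d ((?c k)(0 := h a', 1 := ?B))
        = (\<Sum>b' = 3..<6. \<beta> b' * column_det d ((?c k)(0 := h a', 1 := h b')))"
      using d by (intro column_det_sum) auto
    then show "(\<Sum>b' = 3..<6. \<alpha> a' * \<beta> b' * column_det d ((?c k)(0 := h a', 1 := h b')))
        = \<alpha> a' * column_det d ((?c k)(0 := h a', 1 := ?B))"
      by (simp only: sum_distrib_left mult.assoc)
  qed simp
  also have "\<dots> = (\<Sum>a<3. \<alpha> a * column_det d ((?c k)(1 := ?B, 0 := h a)))"
    by (simp add: fun_upd_twist)
  also have "\<dots> = column_det d ((?c k)(1 := ?B, 0 := ?A))"
    using d by (intro column_det_sum[symmetric]) auto
  also have "\<dots> = (\<Sum>i = 2..<d. s i * column_det d ((?c k)(1 := ?B, 0 := ?g i)))"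
    using d \<alpha> by (intro column_det_sum) auto
  also have "\<dots> = (\<Sum>i = 2..<d. s i * column_det d ((?c k)(0 := ?g i, 1 := ?B)))"
    by (simp add: fun_upd_twist)
  also have "\<dots> = (\<Sum>i = 2..<d. s i * (\<Sum>l = 2..<d. t l * column_det d ((?c k)(0 := ?g i, 1 := ?g l))))"
    using d \<beta> by (subst column_det_sum[where y = ?B and I = "{2..<d}" and t = t and u = ?g]) auto
  also have "\<dots> = 0" using vanish by simp
  finally show "(\<Sum>a<3. \<Sum>b = 3..<6. \<alpha> a * \<beta> b * column_det d ((flap_columns h a b)(k := x))) = 0" .
qed

lemma generic_flap_stress:
  assumes gen: "generic d K p" and V: "{..<d + 4} \<subseteq> vertices K" and d: "d \<ge> 2"
  shows "\<exists>\<alpha> \<beta>. \<alpha> 2 \<noteq> 0 \<and> \<beta> 5 \<noteq> 0 \<and> (\<forall>v j. j < d - 1 \<longrightarrow>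
    (\<Sum>a<3. \<Sum>b = 3..<6. \<alpha> a * \<beta> b * volume_rigidity_entry d p (flap d a b) v j) = 0)"
proof -
  let ?h = "homogeneous d p"
  have nz: "column_det d (flap_columns ?h u (u + 1)) \<noteq> 0" if "u + 1 < 6" for u
  proof -
    define f where "f i = (if i = 0 then u else if i = 1 then u + 1 else i + 4)" for i :: nat
    have "column_det d (\<lambda>i. ?h (f i)) \<noteq> 0"
      using gen V d that
      by (intro generic_column_det_nonzero) (auto simp: f_def inj_on_def)
    also have "(\<lambda>i. ?h (f i)) = flap_columns ?h u (u + 1)"
      unfolding f_def flap_columns_def by auto
    finally show ?thesis .
  qed
  obtain \<alpha> s where \<alpha>: "\<alpha> 2 = -1"
    "\<And>r. r < d \<Longrightarrow> (\<Sum>a<3. \<alpha> a * ?h a r) = (\<Sum>i = 2..<d. s i * ?h (i + 4) r)"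
    using triple_relation_modulo_spine[OF nz[of 0] d] by (auto simp: lessThan_atLeast0 numeral_eq_Suc)
  obtain \<beta> t where \<beta>: "\<beta> 5 = -1"
    "\<And>r. r < d \<Longrightarrow> (\<Sum>b = 3..<6. \<beta> b * ?h b r) = (\<Sum>i = 2..<d. t i * ?h (i + 4) r)"
    using triple_relation_modulo_spine[OF nz[of 3] d] by auto
  note balanced = product_stress_balanced[OF \<alpha>(2) \<beta>(2) d]
  have "(\<Sum>a<3. \<Sum>b = 3..<6. \<alpha> a * \<beta> b * volume_rigidity_entry d p (flap d a b) v j) = 0"
    if j: "j < d - 1" for v j
  proof -
    let ?E = "\<lambda>a b. volume_rigidity_entry d p (flap d a b) v j"
    let ?e = "\<lambda>r. of_bool (r = j) :: real"
    note E = volume_rigidity_entry_flap[OF _ _ j d]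
    consider "v < 3" | "3 \<le> v" "v < 6" | "6 \<le> v" "v < d + 4" | "d + 4 \<le> v" "6 \<le> v"
      using d by linarith
    then show ?thesis
    proof cases
      case 1
      have "(\<Sum>b = 3..<6. \<alpha> a * \<beta> b * ?E a b) = 0" if "a < 3" for a
      proof (cases "a = v")
        case True
        have "(\<Sum>b = 3..<6. \<alpha> a * \<beta> b * ?E a b)
            = \<alpha> a * (\<Sum>b = 3..<6. \<beta> b * column_det d ((flap_columns ?h a b)(0 := ?e)))"
          using 1 unfolding sum_distrib_left True by (intro sum.cong) (auto simp: E(1))
        then show ?thesis using balanced(2) by simp
      next
        case False
        then show ?thesis using 1 that by (intro sum.neutral) (auto simp: volume_rigidity_entry_def flap_def)
      qed
      then show ?thesis by simp
    next
      case 2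
      have "(\<Sum>a<3. \<alpha> a * \<beta> b * ?E a b) = 0" if "3 \<le> b" "b < 6" for b
      proof (cases "b = v")
        case True
        have "(\<Sum>a<3. \<alpha> a * \<beta> b * ?E a b)
            = \<beta> b * (\<Sum>a<3. \<alpha> a * column_det d ((flap_columns ?h a b)(1 := ?e)))"
          using 2 unfolding sum_distrib_left True by (intro sum.cong) (auto simp: E(2))
        then show ?thesis using balanced(1) by simp
      next
        case False
        then show ?thesis using 2 that by (intro sum.neutral) (auto simp: volume_rigidity_entry_def flap_def)
      qed
      then show ?thesis by (subst sum.swap) simp
    next
      case 3
      have "(\<Sum>a<3. \<Sum>b = 3..<6. \<alpha> a * \<beta> b * ?E a b)
          = (\<Sum>a<3. \<Sum>b = 3..<6. \<alpha> a * \<beta> b * column_det d ((flap_columns ?h a b)(v - 4 := ?e)))"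
        using 3 by (intro sum.cong) (auto simp: E(3))
      also have "\<dots> = 0" using 3 by (intro balanced(3)) auto
      finally show ?thesis .
    next
      case 4
      then show ?thesis by (intro sum.neutral ballI) (auto simp: volume_rigidity_entry_def flap_def)
    qed
  qed
  then show ?thesis using \<alpha>(1) \<beta>(1) by (intro exI[of _ \<alpha>] exI[of _ \<beta>]) simp
qed

text \<open>
  The product stress lives on the flaps; it is extended by zero to the other top faces.
\<close>

lemma flap_complex_rank_deficient:
  assumes gen: "generic d K p" and V: "{..<d + 4} \<subseteq> vertices K" and d: "d \<ge> 2"
    and fin: "finite K" "finite (vertices K)"
    and flaps: "\<And>a b. \<lbrakk>a < 3; 3 \<le> b; b < 6\<rbrakk> \<Longrightarrow> flap d a b \<in> top_faces d K"
  shows "mat_rank (volume_rigidity_mat d K p) < card (top_faces d K)"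
proof -
  obtain \<alpha> \<beta> where nz: "\<alpha> 2 \<noteq> 0" "\<beta> 5 \<noteq> 0" and bal: "\<And>v j. j < d - 1 \<Longrightarrow>
    (\<Sum>a<3. \<Sum>b = 3..<6. \<alpha> a * \<beta> b * volume_rigidity_entry d p (flap d a b) v j) = 0"
    using generic_flap_stress[OF gen V d] by blast
  let ?I = "{..<3} \<times> {3..<6} :: (nat \<times> nat) set" and ?F = "\<lambda>(a, b). flap d a b"
  define \<omega> where "\<omega> \<sigma> = (if \<sigma> \<in> ?F ` ?I
    then (\<lambda>(a, b). \<alpha> a * \<beta> b) (the_inv_into ?I ?F \<sigma>) else 0)" for \<sigma>
  have \<omega>: "\<omega> (flap d a b) = \<alpha> a * \<beta> b" if "(a, b) \<in> ?I" for a b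
    using the_inv_into_f_f[OF inj_on_flap that] that unfolding \<omega>_def by force
  show ?thesis
  proof (rule rank_less_if_stress[OF fin d])
    show "flap d 2 5 \<in> top_faces d K" by (rule flaps) auto
    show "\<omega> (flap d 2 5) \<noteq> 0" using nz by (simp add: \<omega>)
    fix v j assume j: "j < d - 1"
    have "(\<Sum>\<sigma>\<in>top_faces d K. \<omega> \<sigma> * volume_rigidity_entry d p \<sigma> v j)
        = (\<Sum>\<sigma>\<in>?F ` ?I. \<omega> \<sigma> * volume_rigidity_entry d p \<sigma> v j)"
      using fin flaps by (intro sum.mono_neutral_right) (auto simp: top_faces_def \<omega>_def)
    also have "\<dots> = (\<Sum>(a, b)\<in>?I. \<alpha> a * \<beta> b * volume_rigidity_entry d p (flap d a b) v j)"
      unfolding sum.reindex[OF inj_on_flap] by (intro sum.cong) (auto simp: \<omega>)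
    also have "\<dots> = 0" unfolding sum.cartesian_product[symmetric] by (rule bal[OF j])
    finally show "(\<Sum>\<sigma>\<in>top_faces d K. \<omega> \<sigma> * volume_rigidity_entry d p \<sigma> v j) = 0" .
  qed
qed

theorem corollary1p4:
  fixes d :: nat
  assumes "d \<ge> 3"
  shows "\<exists>K :: nat set set.
           abstract_complex K \<and> complex_dim K = int d - 1 \<and>
           tight d (int d - 1) ((int d)\<^sup>2 - int d - 1) K \<and>
           \<not> volume_rigid d K"
proof -
  obtain k where d: "d = k + 3" using assms by (metis add.commute le_Suc_ex)
  let ?K = "facet_complex k"
  have tight: "tight d (int d - 1) ((int d)\<^sup>2 - int d - 1) ?K"
    unfolding d by (rule tight_facet_complex)
  have "mat_rank (volume_rigidity_mat d ?K p) < card (top_faces d ?K)" if "generic d ?K p" for p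
  proof (rule flap_complex_rank_deficient[OF that])
    show "finite ?K" using abstract_facet_complex unfolding abstract_complex_def by blast
    show "flap d a b \<in> top_faces d ?K" if "a < 3" "3 \<le> b" "b < 6" for a b
      using flap_in_facets[OF that] unfolding d top_faces_facet_complex .
  qed (auto simp: vertices_facet_complex d)
  then have "\<not> volume_rigid d ?K"
    using tight unfolding volume_rigid_def tight_def by fastforce
  then show ?thesis
    using abstract_facet_complex dim_facet_complex tight unfolding d by blast
qed

end
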